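(* Let $\boldsymbol{x}^*\in\mathbb{R}^{N_D}$ be a solution of the domain-decomposed full order model (DD-FOM), i.e. $\boldsymbol{r}_i(\boldsymbol{x}_i^{\Omega*},\boldsymbol{x}_i^{\Gamma*})=\boldsymbol{0}$ for $i=1,\dots,n_\Omega$ and $\sum_{i=1}^{n_\Omega}\boldsymbol{A}_i\boldsymbol{x}_i^{\Gamma*}=\boldsymbol{0}$. Let $\widehat{\boldsymbol{x}}^*\in\mathbb{R}^{n_D}$ be a (local) solution of the reduced order model (ROM) $$\min_{\widehat{\boldsymbol{x}}}\ \frac12\sum_{i=1}^{n_\Omega}\big\|\boldsymbol{B}_i\boldsymbol{r}_i\big(\boldsymbol{g}_i^\Omega(\widehat{\boldsymbol{x}}_i^\Omega),\boldsymbol{g}_i^\Gamma(\widehat{\boldsymbol{x}}_i^\Gamma)\big)\big\|_2^2\quad\text{s.t.}\quad\sum_{i=1}^{n_\Omega}\widetilde{\boldsymbol{A}}_i(\widehat{\boldsymbol{x}}_i^\Gamma)=\boldsymbol{0},$$ in either the weak FOM-port constraint formulation or the strong ROM-port constraint formulation, and let $\mathcal{S}_{\rm ROM}$ denote the feasible set of this problem. If there exists $\kappa_\ell>0$ such that $$\Big(\sum_{i=1}^{n_\Omega}\|\boldsymbol{r}_i(\boldsymbol{y}_i^\Omega,\boldsymbol{y}_i^\Gamma)-\boldsymbol{r}_i(\boldsymbol{z}_i^\Omega,\boldsymbol{z}_i^\Gamma)\|_2^2\Big)^{1/2}\ge\kappa_\ell\|\boldsymbol{y}-\boldsymbol{z}\|_2\qquad\forall\,\boldsymbol{y},\boldsymbol{z}\in\mathbb{R}^{N_D},$$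 and if there exists $P>0$ such that $$\Big(\sum_{i=1}^{n_\Omega}\|\boldsymbol{B}_i\boldsymbol{r}_i(\boldsymbol{y}_i^\Omega,\boldsymbol{y}_i^\Gamma)\|_2^2\Big)^{1/2}\ge P\Big(\sum_{i=1}^{n_\Omega}\|\boldsymbol{r}_i(\boldsymbol{y}_i^\Omega,\boldsymbol{y}_i^\Gamma)\|_2^2\Big)^{1/2}\qquad\forall\,\boldsymbol{y}\in\boldsymbol{g}(\mathcal{S}_{\rm ROM}),$$ then $$\|\boldsymbol{x}^*-\boldsymbol{g}(\widehat{\boldsymbol{x}}^* )\|_2\le\frac{1}{P\kappa_\ell}\Big(\sum_{i=1}^{n_\Omega}\big\|\boldsymbol{B}_i\boldsymbol{r}_i\big(\boldsymbol{g}_i^\Omega(\widehat{\boldsymbol{x}}_i^{\Omega*}),\boldsymbol{g}_i^\Gamma(\widehat{\boldsymbol{x}}_i^{\Gamma*})\big)\big\|_2^2\Big)^{1/2}.$$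
   Context: There are $n_\Omega$ subdomains. For each $i=1,\dots,n_\Omega$: $\boldsymbol{r}_i:\mathbb{R}^{N_i^\Omega}\times\mathbb{R}^{N_i^\Gamma}\to\mathbb{R}^{N_i^r}$ is the subdomain residual function of the full order model; $\boldsymbol{A}_i\in\{-1,0,1\}^{N_A\times N_i^\Gamma}$ are the constraint matrices expressing equality of the duplicated interface state variables of neighboring subdomains; $\boldsymbol{B}_i\in\mathbb{R}^{N_i^B\times N_i^r}$, $N_i^B\le N_i^r$, is a given hyper-reduction matrix; $\boldsymbol{g}_i^\Omega:\mathbb{R}^{n_i^\Omega}\to\mathbb{R}^{N_i^\Omega}$ and $\boldsymbol{g}_i^\Gamma:\mathbb{R}^{n_i^\Gamma}\to\mathbb{R}^{N_i^\Gamma}$ are given maps from reduced to full subdomain states. Notation: $N_D=\sum_i(N_i^\Omega+N_i^\Gamma)$, $n_D=\sum_i(n_i^\Omega+n_i^\Gamma)$. A vector $\boldsymbol{y}\in\mathbb{R}^{N_D}$ is written in blocks $\boldsymbol{y}=(\boldsymbol{y}_1^\Omega,\boldsymbol{y}_1^\Gamma,\dots,\boldsymbol{y}_{n_\Omega}^\Omega,\boldsymbol{y}_{n_\Omega}^\Gamma)$ with $\boldsymbol{y}_i^\Omega\in\mathbb{R}^{N_i^\Omega}$, $\boldsymbol{y}_i^\Gamma\in\mathbb{R}^{N_i^\Gamma}$, and analogously $\widehat{\boldsymbol{x}}=(\widehat{\boldsymbol{x}}_1^\Omega,\widehat{\boldsymbol{x}}_1^\Gamma,\dots,\widehat{\boldsymbol{x}}_{n_\Omega}^\Omega,\widehat{\boldsymbol{x}}_{n_\Omega}^\Gamma)\in\mathbb{R}^{n_D}$.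 The lifting map is $\boldsymbol{g}(\widehat{\boldsymbol{x}})=(\boldsymbol{g}_1^\Omega(\widehat{\boldsymbol{x}}_1^\Omega),\boldsymbol{g}_1^\Gamma(\widehat{\boldsymbol{x}}_1^\Gamma),\dots,\boldsymbol{g}_{n_\Omega}^\Omega(\widehat{\boldsymbol{x}}_{n_\Omega}^\Omega),\boldsymbol{g}_{n_\Omega}^\Gamma(\widehat{\boldsymbol{x}}_{n_\Omega}^\Gamma))\in\mathbb{R}^{N_D}$. The ROM constraint functions $\widetilde{\boldsymbol{A}}_i$ are one of the following. Weak FOM-port constraints: $\widetilde{\boldsymbol{A}}_i(\widehat{\boldsymbol{x}}_i^\Gamma)=\boldsymbol{C}\boldsymbol{A}_i\boldsymbol{g}_i^\Gamma(\widehat{\boldsymbol{x}}_i^\Gamma)$ with a given matrix $\boldsymbol{C}\in\mathbb{R}^{n_C\times N_A}$. Strong ROM-port constraints: $\widetilde{\boldsymbol{A}}_i(\widehat{\boldsymbol{x}}_i^\Gamma)=\widehat{\boldsymbol{A}}_i\widehat{\boldsymbol{x}}_i^\Gamma$ with given matrices $\widehat{\boldsymbol{A}}_i\in\{-1,0,1\}^{n_A\times n_i^\Gamma}$ encoding equality of shared reduced port variables (in this formulation the maps $\boldsymbol{g}_i^\Gamma$ are assembled from maps on the individual ports, i.e. on the groups of interface variables shared by a set of subdomains, so that equality of the reduced port variables implies $\sum_i\boldsymbol{A}_i\boldsymbol{g}_i^\Gamma(\widehat{\boldsymbol{x}}_i^\Gamma)=\boldsymbol{0}$). The feasible set is $\mathcal{S}_{\rm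 ROM}=\{\widehat{\boldsymbol{x}}\in\mathbb{R}^{n_D}:\sum_{i=1}^{n_\Omega}\widetilde{\boldsymbol{A}}_i(\widehat{\boldsymbol{x}}_i^\Gamma)=\boldsymbol{0}\}$. *)

theory Defs
  imports Complex_Main "Jordan_Normal_Form.Matrix"
begin

text \<open>
  Subdomains are indexed by \<open>i < n\<close>; all dimensions are functions of \<open>i\<close>, and vectors and matrices
  carry their dimensions explicitly.
\<close>

definition l2norm :: "real vec \<Rightarrow> real" where
  "l2norm v = sqrt (v \<bullet> v)"


subsection \<open>Block vectors\<close>

text \<open>
  With interior block sizes \<open>a\<close> and interface block sizes \<open>b\<close>, a vector of dimension
  \<open>total_dim n a b\<close> is laid out as (interior 0, interface 0, interior 1, interface 1, ...).
\<close>

definition total_dim :: "nat \<Rightarrow> (nat \<Rightarrow> nat) \<Rightarrow> (nat \<Rightarrow> nat) \<Rightarrow> nat" where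
  "total_dim n a b = (\<Sum>i<n. a i + b i)"

definition interior_block :: "(nat \<Rightarrow> nat) \<Rightarrow> (nat \<Rightarrow> nat) \<Rightarrow> real vec \<Rightarrow> nat \<Rightarrow> real vec" where
  "interior_block a b y i = vec (a i) (\<lambda>k. y $ (total_dim i a b + k))"

definition interface_block :: "(nat \<Rightarrow> nat) \<Rightarrow> (nat \<Rightarrow> nat) \<Rightarrow> real vec \<Rightarrow> nat \<Rightarrow> real vec" where
  "interface_block a b y i = vec (b i) (\<lambda>k. y $ (total_dim i a b + a i + k))"

primrec assemble_blocks :: "nat \<Rightarrow> (nat \<Rightarrow> real vec) \<Rightarrow> (nat \<Rightarrow> real vec) \<Rightarrow> real vec" where
  "assemble_blocks 0 u v = 0\<^sub>v 0"
| "assemble_blocks (Suc n) u v = assemble_blocks n u v @\<^sub>v (u n @\<^sub>v v n)"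

text \<open>The lifting map; \<open>a\<close> and \<open>b\<close> are the reduced block sizes.\<close>

definition lift_map ::
  "nat \<Rightarrow> (nat \<Rightarrow> nat) \<Rightarrow> (nat \<Rightarrow> nat) \<Rightarrow> (nat \<Rightarrow> real vec \<Rightarrow> real vec) \<Rightarrow> (nat \<Rightarrow> real vec \<Rightarrow> real vec)
    \<Rightarrow> real vec \<Rightarrow> real vec" where
  "lift_map n a b g_Om g_Ga x =
     assemble_blocks n (\<lambda>i. g_Om i (interior_block a b x i)) (\<lambda>i. g_Ga i (interface_block a b x i))"

lemma assemble_blocks_carrier:
  assumes "\<And>i. i < n \<Longrightarrow> u i \<in> carrier_vec (a i)" "\<And>i. i < n \<Longrightarrow> v i \<in> carrier_vec (b i)"
  shows "assemble_blocks n u v \<in> carrier_vec (total_dim n a b)"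
  using assms
proof (induction n)
  case (Suc n)
  have "assemble_blocks n u v \<in> carrier_vec (total_dim n a b)"
    by (rule Suc.IH) (rule Suc.prems, simp)+
  moreover have "u n \<in> carrier_vec (a n)" "v n \<in> carrier_vec (b n)"
    by (rule Suc.prems, simp)+
  ultimately have "assemble_blocks n u v @\<^sub>v (u n @\<^sub>v v n)
      \<in> carrier_vec (total_dim n a b + (a n + b n))"
    by (intro append_carrier_vec)
  then show ?case by (simp add: total_dim_def)
qed (simp add: total_dim_def)

lemma assemble_blocks_index:
  assumes "\<And>i. i < n \<Longrightarrow> u i \<in> carrier_vec (a i)" "\<And>i. i < n \<Longrightarrow> v i \<in> carrier_vec (b i)"
    and "i < n" "k < a i + b i"
  shows "assemble_blocks n u v $ (total_dim i a b + k) = (u i @\<^sub>v v i) $ k"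
  using assms
proof (induction n)
  case (Suc n)
  have c: "assemble_blocks n u v \<in> carrier_vec (total_dim n a b)"
    by (rule assemble_blocks_carrier) (rule Suc.prems, simp)+
  then have c': "dim_vec (assemble_blocks n u v) = total_dim n a b" by (rule carrier_vecD)
  have d: "dim_vec (u n) = a n" "dim_vec (v n) = b n"
    by (rule carrier_vecD, rule Suc.prems, simp)+
  show ?case
  proof (cases "i = n")
    case True
    then show ?thesis using c' d Suc.prems(4) by simp
  next
    case False
    then have lt: "i < n" using Suc.prems(3) by simp
    have "total_dim (Suc i) a b \<le> total_dim n a b"
      unfolding total_dim_def by (rule sum_mono2) (use lt in auto)
    then have "total_dim i a b + k < total_dim n a b"
      using Suc.prems(4) by (simp add: total_dim_def)
    moreover have "assemble_blocks n u v $ (total_dim i a b + k) = (u i @\<^sub>v v i) $ k"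
      using lt Suc.prems(4) by (intro Suc.IH) (auto intro: Suc.prems)
    ultimately show ?thesis using c' d by simp
  qed
qed simp

lemma blocks_assemble_blocks:
  assumes "\<And>i. i < n \<Longrightarrow> u i \<in> carrier_vec (a i)" "\<And>i. i < n \<Longrightarrow> v i \<in> carrier_vec (b i)"
    and "i < n"
  shows "interior_block a b (assemble_blocks n u v) i = u i"
    and "interface_block a b (assemble_blocks n u v) i = v i"
proof -
  have d: "dim_vec (u i) = a i" "dim_vec (v i) = b i"
    using assms(1,2)[OF assms(3)] by (auto dest: carrier_vecD)
  have idx: "assemble_blocks n u v $ (total_dim i a b + k) = (u i @\<^sub>v v i) $ k"
    if "k < a i + b i" for k
    by (rule assemble_blocks_index[of n u a v b i k]) (use assms that in blast)+
  show "interior_block a b (assemble_blocks n u v) i = u i"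
  proof (rule eq_vecI)
    fix k assume "k < dim_vec (u i)"
    then show "interior_block a b (assemble_blocks n u v) i $ k = u i $ k"
      using d idx[of k] by (simp add: interior_block_def)
  qed (simp add: interior_block_def d)
  show "interface_block a b (assemble_blocks n u v) i = v i"
  proof (rule eq_vecI)
    fix k assume "k < dim_vec (v i)"
    then show "interface_block a b (assemble_blocks n u v) i $ k = v i $ k"
      using d idx[of "a i + k"] by (simp add: interface_block_def add.assoc)
  qed (simp add: interface_block_def d)
qed

lemma blocks_lift_map:
  assumes "\<And>i. i < n \<Longrightarrow> g_Om i \<in> carrier_vec (a i) \<rightarrow> carrier_vec (N_Om i)"
    and "\<And>i. i < n \<Longrightarrow> g_Ga i \<in> carrier_vec (b i) \<rightarrow> carrier_vec (N_Ga i)"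
    and "i < n"
  shows "interior_block N_Om N_Ga (lift_map n a b g_Om g_Ga x) i = g_Om i (interior_block a b x i)"
    and "interface_block N_Om N_Ga (lift_map n a b g_Om g_Ga x) i = g_Ga i (interface_block a b x i)"
proof -
  have u: "g_Om j (interior_block a b x j) \<in> carrier_vec (N_Om j)" if "j < n" for j
    using assms(1)[OF that] by (rule funcset_mem) (simp add: interior_block_def)
  have v: "g_Ga j (interface_block a b x j) \<in> carrier_vec (N_Ga j)" if "j < n" for j
    using assms(2)[OF that] by (rule funcset_mem) (simp add: interface_block_def)
  show "interior_block N_Om N_Ga (lift_map n a b g_Om g_Ga x) i = g_Om i (interior_block a b x i)"
    unfolding lift_map_def by (rule blocks_assemble_blocks(1)[OF u v assms(3)])
  show "interface_block N_Om N_Ga (lift_map n a b g_Om g_Ga x) i = g_Ga i (interface_block a b x i)"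
    unfolding lift_map_def by (rule blocks_assemble_blocks(2)[OF u v assms(3)])
qed


subsection \<open>Interface variables, ports and equality constraints\<close>

text \<open>
  Subdomain \<open>i\<close> touches the ports in \<open>Q i\<close>, and port \<open>p\<close> carries \<open>D p\<close> variables. The \<open>k\<close>-th entry of
  the interface vector of subdomain \<open>i\<close> is its copy of the variable \<open>var i k = (p, l)\<close>, that is, of
  the \<open>l\<close>-th variable of port \<open>p\<close>. Every subdomain touching \<open>p\<close> has exactly one copy of each variable
  of \<open>p\<close>, and no other interface variables than those of its ports.
\<close>

definition port_layout ::
  "nat \<Rightarrow> (nat \<Rightarrow> nat) \<Rightarrow> (nat \<Rightarrow> nat set) \<Rightarrow> (nat \<Rightarrow> nat) \<Rightarrow> (nat \<Rightarrow> nat \<Rightarrow> nat \<times> nat) \<Rightarrow> bool" where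
  "port_layout n d Q D var \<longleftrightarrow>
     (\<forall>i<n. bij_betw (var i) {..<d i} (SIGMA p:Q i. {..<D p}))"

text \<open>
  The matrices \<open>M i\<close>, with entries in \<open>{-1, 0, 1}\<close>, express equality of all copies of the same
  interface variable. No particular choice of rows is fixed; redundant rows are allowed.
\<close>

definition equality_constraints ::
  "nat \<Rightarrow> nat \<Rightarrow> (nat \<Rightarrow> nat) \<Rightarrow> (nat \<Rightarrow> nat \<Rightarrow> nat \<times> nat) \<Rightarrow> (nat \<Rightarrow> real mat) \<Rightarrow> bool" where
  "equality_constraints n m d var M \<longleftrightarrow>
     (\<forall>i<n. M i \<in> carrier_mat m (d i) \<and> elements_mat (M i) \<subseteq> {-1, 0, 1}) \<and>
     (\<forall>x. (\<forall>i<n. x i \<in> carrier_vec (d i)) \<longrightarrow>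
        (finsum_vec TYPE(real) m (\<lambda>i. M i *\<^sub>v x i) {..<n} = 0\<^sub>v m \<longleftrightarrow>
         (\<forall>i<n. \<forall>j<n. \<forall>k<d i. \<forall>l<d j. var i k = var j l \<longrightarrow> x i $ k = x j $ l)))"

definition port_vec ::
  "(nat \<Rightarrow> nat) \<Rightarrow> (nat \<Rightarrow> nat) \<Rightarrow> (nat \<Rightarrow> nat \<Rightarrow> nat \<times> nat) \<Rightarrow> nat \<Rightarrow> nat \<Rightarrow> real vec \<Rightarrow> real vec" where
  "port_vec d D var i p x = vec (D p) (\<lambda>l. x $ (inv_into {..<d i} (var i) (p, l)))"

text \<open>
  The interface maps \<open>g_Ga i\<close> are assembled from one map \<open>g_port p\<close> per port (the same map for all
  subdomains sharing the port), applied to the reduced variables of that port.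
\<close>

definition assembled_from_ports ::
  "nat \<Rightarrow> (nat \<Rightarrow> nat) \<Rightarrow> (nat \<Rightarrow> nat) \<Rightarrow> (nat \<Rightarrow> nat set) \<Rightarrow> (nat \<Rightarrow> nat) \<Rightarrow> (nat \<Rightarrow> nat)
    \<Rightarrow> (nat \<Rightarrow> nat \<Rightarrow> nat \<times> nat) \<Rightarrow> (nat \<Rightarrow> nat \<Rightarrow> nat \<times> nat)
    \<Rightarrow> (nat \<Rightarrow> real vec \<Rightarrow> real vec) \<Rightarrow> (nat \<Rightarrow> real vec \<Rightarrow> real vec) \<Rightarrow> bool" where
  "assembled_from_ports n N_Ga n_Ga Q N_port n_port var rvar g_port g_Ga \<longleftrightarrow>
     (\<forall>i<n. \<forall>p\<in>Q i. g_port p \<in> carrier_vec (n_port p) \<rightarrow> carrier_vec (N_port p)) \<and>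
     (\<forall>i<n. \<forall>x\<in>carrier_vec (n_Ga i). \<forall>p\<in>Q i.
        port_vec N_Ga N_port var i p (g_Ga i x) = g_port p (port_vec n_Ga n_port rvar i p x))"


subsection \<open>ROM constraints\<close>

definition weak_fom_port_constraints ::
  "nat \<Rightarrow> nat \<Rightarrow> nat \<Rightarrow> (nat \<Rightarrow> nat) \<Rightarrow> (nat \<Rightarrow> real mat) \<Rightarrow> (nat \<Rightarrow> real vec \<Rightarrow> real vec)
    \<Rightarrow> (nat \<Rightarrow> real vec \<Rightarrow> real vec) \<Rightarrow> bool" where
  "weak_fom_port_constraints n m N_A n_Ga A g_Ga At \<longleftrightarrow>
     (\<exists>C\<in>carrier_mat m N_A. \<forall>i<n. \<forall>x\<in>carrier_vec (n_Ga i). At i x = C *\<^sub>v (A i *\<^sub>v g_Ga i x))"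

definition strong_rom_port_constraints ::
  "nat \<Rightarrow> nat \<Rightarrow> (nat \<Rightarrow> nat) \<Rightarrow> (nat \<Rightarrow> nat) \<Rightarrow> (nat \<Rightarrow> nat set) \<Rightarrow> (nat \<Rightarrow> nat)
    \<Rightarrow> (nat \<Rightarrow> nat \<Rightarrow> nat \<times> nat) \<Rightarrow> (nat \<Rightarrow> real vec \<Rightarrow> real vec)
    \<Rightarrow> (nat \<Rightarrow> real vec \<Rightarrow> real vec) \<Rightarrow> bool" where
  "strong_rom_port_constraints n m N_Ga n_Ga Q N_port var g_Ga At \<longleftrightarrow>
     (\<exists>n_port rvar g_port Ahat.
        port_layout n n_Ga Q n_port rvar \<and>
        assembled_from_ports n N_Ga n_Ga Q N_port n_port var rvar g_port g_Ga \<and>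
        equality_constraints n m n_Ga rvar Ahat \<and>
        (\<forall>i<n. \<forall>x\<in>carrier_vec (n_Ga i). At i x = Ahat i *\<^sub>v x))"

definition rom_feasible ::
  "nat \<Rightarrow> nat \<Rightarrow> (nat \<Rightarrow> nat) \<Rightarrow> (nat \<Rightarrow> nat) \<Rightarrow> (nat \<Rightarrow> real vec \<Rightarrow> real vec) \<Rightarrow> real vec set" where
  "rom_feasible n m n_Om n_Ga At =
     {x \<in> carrier_vec (total_dim n n_Om n_Ga).
        finsum_vec TYPE(real) m (\<lambda>i. At i (interface_block n_Om n_Ga x i)) {..<n} = 0\<^sub>v m}"

text \<open>Consistency check: strong constraints imply the full interface constraints after lifting.\<close>

lemma strong_rom_port_constraints_imp_compatible:
  assumes lay: "port_layout n N_Ga Q N_port var"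
    and eqA: "equality_constraints n N_A N_Ga var A"
    and g: "\<And>i. i < n \<Longrightarrow> g_Ga i \<in> carrier_vec (n_Ga i) \<rightarrow> carrier_vec (N_Ga i)"
    and strong: "strong_rom_port_constraints n m N_Ga n_Ga Q N_port var g_Ga At"
    and x: "\<And>i. i < n \<Longrightarrow> x i \<in> carrier_vec (n_Ga i)"
    and feas: "finsum_vec TYPE(real) m (\<lambda>i. At i (x i)) {..<n} = 0\<^sub>v m"
  shows "finsum_vec TYPE(real) N_A (\<lambda>i. A i *\<^sub>v g_Ga i (x i)) {..<n} = 0\<^sub>v N_A"
proof -
  obtain n_port rvar g_port Ahat where
    rlay: "port_layout n n_Ga Q n_port rvar" and
    asm: "assembled_from_ports n N_Ga n_Ga Q N_port n_port var rvar g_port g_Ga" and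
    eqR: "equality_constraints n m n_Ga rvar Ahat" and
    At: "\<forall>i<n. \<forall>x\<in>carrier_vec (n_Ga i). At i x = Ahat i *\<^sub>v x"
    using strong unfolding strong_rom_port_constraints_def by blast
  have Ahc: "Ahat i *\<^sub>v x i \<in> carrier_vec m" if "i < n" for i
    using eqR x[OF that] that unfolding equality_constraints_def by (meson mult_mat_vec_carrier)
  have "finsum_vec TYPE(real) m (\<lambda>i. Ahat i *\<^sub>v x i) {..<n} = 0\<^sub>v m"
  proof -
    have "finsum_vec TYPE(real) m (\<lambda>i. At i (x i)) {..<n} =
          finsum_vec TYPE(real) m (\<lambda>i. Ahat i *\<^sub>v x i) {..<n}"
    proof (rule eq_vecI)
      fix k assume k: "k < dim_vec (finsum_vec TYPE(real) m (\<lambda>i. Ahat i *\<^sub>v x i) {..<n})"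
      have "finsum_vec TYPE(real) m (\<lambda>i. Ahat i *\<^sub>v x i) {..<n} \<in> carrier_vec m"
        using Ahc by (intro finsum_vec_closed) auto
      with k have k': "k < m" by auto
      show "finsum_vec TYPE(real) m (\<lambda>i. At i (x i)) {..<n} $ k =
            finsum_vec TYPE(real) m (\<lambda>i. Ahat i *\<^sub>v x i) {..<n} $ k"
        using At x Ahc k' by (subst (1 2) index_finsum_vec) auto
    next
      show "dim_vec (finsum_vec TYPE(real) m (\<lambda>i. At i (x i)) {..<n}) =
            dim_vec (finsum_vec TYPE(real) m (\<lambda>i. Ahat i *\<^sub>v x i) {..<n})"
        using At x Ahc
          finsum_vec_closed[of "\<lambda>i. At i (x i)" "{..<n}" m]
          finsum_vec_closed[of "\<lambda>i. Ahat i *\<^sub>v x i" "{..<n}" m] by auto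
    qed
    then show ?thesis using feas by simp
  qed
  then have eqx: "x i $ k = x j $ l"
    if "i < n" "j < n" "k < n_Ga i" "l < n_Ga j" "rvar i k = rvar j l" for i j k l
    using eqR x that unfolding equality_constraints_def by blast
  have port_eq: "port_vec n_Ga n_port rvar i p (x i) = port_vec n_Ga n_port rvar j p (x j)"
    if ij: "i < n" "j < n" and p: "p \<in> Q i" "p \<in> Q j" for i j p
  proof (rule eq_vecI)
    fix l assume "l < dim_vec (port_vec n_Ga n_port rvar j p (x j))"
    then have l: "l < n_port p" by (simp add: port_vec_def)
    have inv: "inv_into {..<n_Ga h} (rvar h) (p, l) < n_Ga h"
      "rvar h (inv_into {..<n_Ga h} (rvar h) (p, l)) = (p, l)" if "h < n" "p \<in> Q h" for h
    proof -
      have "(p, l) \<in> rvar h ` {..<n_Ga h}"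
        using rlay that l unfolding port_layout_def by (auto simp: bij_betw_def)
      then show "inv_into {..<n_Ga h} (rvar h) (p, l) < n_Ga h"
        "rvar h (inv_into {..<n_Ga h} (rvar h) (p, l)) = (p, l)"
        using inv_into_into[of "(p, l)" "rvar h" "{..<n_Ga h}"]
          f_inv_into_f[of "(p, l)" "rvar h" "{..<n_Ga h}"] by auto
    qed
    show "port_vec n_Ga n_port rvar i p (x i) $ l = port_vec n_Ga n_port rvar j p (x j) $ l"
      using eqx[of i j] ij inv[OF ij(1) p(1)] inv[OF ij(2) p(2)] l by (simp add: port_vec_def)
  qed (simp add: port_vec_def)
  have entry: "g_Ga i (x i) $ k = g_port p (port_vec n_Ga n_port rvar i p (x i)) $ l"
    "p \<in> Q i" "l < N_port p"
    if "i < n" "k < N_Ga i" "var i k = (p, l)" for i k p l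
  proof -
    have bij: "bij_betw (var i) {..<N_Ga i} (SIGMA p:Q i. {..<N_port p})"
      using lay that(1) unfolding port_layout_def by blast
    then have "(p, l) \<in> (SIGMA p:Q i. {..<N_port p})"
      using bij_betwE[OF bij] that by (metis lessThan_iff)
    then show pl: "p \<in> Q i" "l < N_port p" by auto
    have "inv_into {..<N_Ga i} (var i) (p, l) = k"
      using bij that by (metis bij_betw_inv_into_left lessThan_iff)
    then have "g_Ga i (x i) $ k = port_vec N_Ga N_port var i p (g_Ga i (x i)) $ l"
      using pl by (simp add: port_vec_def)
    then show "g_Ga i (x i) $ k = g_port p (port_vec n_Ga n_port rvar i p (x i)) $ l"
      using asm x pl that(1) unfolding assembled_from_ports_def by simp
  qed
  have gval: "g_Ga i (x i) $ k = g_Ga j (x j) $ l"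
    if "i < n" "j < n" "k < N_Ga i" "l < N_Ga j" "var i k = var j l" for i j k l
  proof -
    obtain p q where pq: "var i k = (p, q)" by fastforce
    with that(5) have pq': "var j l = (p, q)" by simp
    show ?thesis
      unfolding entry(1)[OF that(1,3) pq] entry(1)[OF that(2,4) pq']
      using port_eq[OF that(1,2) entry(2)[OF that(1,3) pq] entry(2)[OF that(2,4) pq']]
      by (rule arg_cong)
  qed
  have "\<forall>i<n. g_Ga i (x i) \<in> carrier_vec (N_Ga i)"
    using g x by blast
  then have "finsum_vec TYPE(real) N_A (\<lambda>i. A i *\<^sub>v g_Ga i (x i)) {..<n} = 0\<^sub>v N_A \<longleftrightarrow>
       (\<forall>i<n. \<forall>j<n. \<forall>k<N_Ga i. \<forall>l<N_Ga j. var i k = var j l \<longrightarrow>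
          g_Ga i (x i) $ k = g_Ga j (x j) $ l)"
    by (rule mp[OF spec[OF conjunct2[OF eqA[unfolded equality_constraints_def]],
          of "\<lambda>i. g_Ga i (x i)"]])
  then show ?thesis
    by (rule iffD2) (intro allI impI gval)
qed


subsection \<open>Full order model and ROM solutions\<close>

definition fom_solution ::
  "nat \<Rightarrow> nat \<Rightarrow> (nat \<Rightarrow> nat) \<Rightarrow> (nat \<Rightarrow> nat) \<Rightarrow> (nat \<Rightarrow> nat)
    \<Rightarrow> (nat \<Rightarrow> real vec \<Rightarrow> real vec \<Rightarrow> real vec) \<Rightarrow> (nat \<Rightarrow> real mat) \<Rightarrow> real vec \<Rightarrow> bool" where
  "fom_solution n N_A N_Om N_Ga N_r r A x \<longleftrightarrow>
     x \<in> carrier_vec (total_dim n N_Om N_Ga) \<and>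
     (\<forall>i<n. r i (interior_block N_Om N_Ga x i) (interface_block N_Om N_Ga x i) = 0\<^sub>v (N_r i)) \<and>
     finsum_vec TYPE(real) N_A (\<lambda>i. A i *\<^sub>v interface_block N_Om N_Ga x i) {..<n} = 0\<^sub>v N_A"

text \<open>Local minimizers with respect to the Euclidean norm; these include the global ones.\<close>

definition is_local_minimizer :: "(real vec \<Rightarrow> real) \<Rightarrow> real vec set \<Rightarrow> real vec \<Rightarrow> bool" where
  "is_local_minimizer f S x \<longleftrightarrow>
     x \<in> S \<and> (\<exists>\<epsilon>>0. \<forall>y\<in>S. l2norm (y - x) < \<epsilon> \<longrightarrow> f x \<le> f y)"

definition rom_objective ::
  "nat \<Rightarrow> (nat \<Rightarrow> nat) \<Rightarrow> (nat \<Rightarrow> nat) \<Rightarrow> (nat \<Rightarrow> real vec \<Rightarrow> real vec \<Rightarrow> real vec) \<Rightarrow> (nat \<Rightarrow> real mat)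
    \<Rightarrow> (nat \<Rightarrow> real vec \<Rightarrow> real vec) \<Rightarrow> (nat \<Rightarrow> real vec \<Rightarrow> real vec) \<Rightarrow> real vec \<Rightarrow> real" where
  "rom_objective n n_Om n_Ga r B g_Om g_Ga x =
     1 / 2 * (\<Sum>i<n. (l2norm (B i *\<^sub>v r i (g_Om i (interior_block n_Om n_Ga x i))
                                           (g_Ga i (interface_block n_Om n_Ga x i))))\<^sup>2)"

end

theory Submission
  imports Defs
begin

text \<open>
  The full order solution is a zero of the residuals, so the reverse Lipschitz bound, taken between it
  and the lifted ROM solution, bounds the error by the residual norm of the lifted ROM solution alone.
  That point lies in the image of the feasible set, where the hyper-reduced residual norm dominates
  \<open>P\<close> times the full one; dividing by \<open>P * \<kappa>\<close> gives the estimate.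
\<close>

lemma l2norm_zero_minus:
  assumes "v \<in> carrier_vec d"
  shows "l2norm (0\<^sub>v d - v) = l2norm v"
proof -
  have "0\<^sub>v d - v = - v"
    using assms by auto
  then show ?thesis
    using assms by (simp add: l2norm_def)
qed

lemma lift_map_carrier:
  assumes "\<And>i. i < n \<Longrightarrow> g_Om i \<in> carrier_vec (a i) \<rightarrow> carrier_vec (N_Om i)"
    and "\<And>i. i < n \<Longrightarrow> g_Ga i \<in> carrier_vec (b i) \<rightarrow> carrier_vec (N_Ga i)"
  shows "lift_map n a b g_Om g_Ga x \<in> carrier_vec (total_dim n N_Om N_Ga)"
  unfolding lift_map_def
proof (rule assemble_blocks_carrier)
  fix i assume i: "i < n"
  show "g_Om i (interior_block a b x i) \<in> carrier_vec (N_Om i)"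
    using assms(1)[OF i] by (rule funcset_mem) (simp add: interior_block_def)
  show "g_Ga i (interface_block a b x i) \<in> carrier_vec (N_Ga i)"
    using assms(2)[OF i] by (rule funcset_mem) (simp add: interface_block_def)
qed

theorem theorem5:
  fixes n N_A m :: nat
    and N_Om N_Ga N_r N_B n_Om n_Ga N_port :: "nat \<Rightarrow> nat"
    and Q :: "nat \<Rightarrow> nat set"
    and var :: "nat \<Rightarrow> nat \<Rightarrow> nat \<times> nat"
    and r :: "nat \<Rightarrow> real vec \<Rightarrow> real vec \<Rightarrow> real vec"
    and A B :: "nat \<Rightarrow> real mat"
    and g_Om g_Ga At :: "nat \<Rightarrow> real vec \<Rightarrow> real vec"
    and x_star xhat_star :: "real vec"
    and \<kappa> P :: real
  defines "S_ROM \<equiv> rom_feasible n m n_Om n_Ga At"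
    and "g \<equiv> lift_map n n_Om n_Ga g_Om g_Ga"
  assumes r: "\<And>i. i < n \<Longrightarrow>
        r i \<in> carrier_vec (N_Om i) \<rightarrow> carrier_vec (N_Ga i) \<rightarrow> carrier_vec (N_r i)"
    and ports: "port_layout n N_Ga Q N_port var"
    and A: "equality_constraints n N_A N_Ga var A"
    and B: "\<And>i. i < n \<Longrightarrow> B i \<in> carrier_mat (N_B i) (N_r i)" "\<And>i. i < n \<Longrightarrow> N_B i \<le> N_r i"
    and g_Om: "\<And>i. i < n \<Longrightarrow> g_Om i \<in> carrier_vec (n_Om i) \<rightarrow> carrier_vec (N_Om i)"
    and g_Ga: "\<And>i. i < n \<Longrightarrow> g_Ga i \<in> carrier_vec (n_Ga i) \<rightarrow> carrier_vec (N_Ga i)"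
    and constraints:
      "weak_fom_port_constraints n m N_A n_Ga A g_Ga At \<or>
       strong_rom_port_constraints n m N_Ga n_Ga Q N_port var g_Ga At"
    and fom: "fom_solution n N_A N_Om N_Ga N_r r A x_star"
    and rom: "is_local_minimizer (rom_objective n n_Om n_Ga r B g_Om g_Ga) S_ROM xhat_star"
    and kappa_pos: "\<kappa> > 0"
    and inverse_lipschitz:
      "\<And>y z. y \<in> carrier_vec (total_dim n N_Om N_Ga) \<Longrightarrow> z \<in> carrier_vec (total_dim n N_Om N_Ga) \<Longrightarrow>
        sqrt (\<Sum>i<n. (l2norm (r i (interior_block N_Om N_Ga y i) (interface_block N_Om N_Ga y i)
                             - r i (interior_block N_Om N_Ga z i) (interface_block N_Om N_Ga z i)))\<^sup>2)
          \<ge> \<kappa> * l2norm (y - z)"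
    and P_pos: "P > 0"
    and hyper_reduction:
      "\<And>y. y \<in> g ` S_ROM \<Longrightarrow>
        sqrt (\<Sum>i<n. (l2norm (B i *\<^sub>v r i (interior_block N_Om N_Ga y i)
                                          (interface_block N_Om N_Ga y i)))\<^sup>2)
          \<ge> P * sqrt (\<Sum>i<n. (l2norm (r i (interior_block N_Om N_Ga y i)
                                            (interface_block N_Om N_Ga y i)))\<^sup>2)"
  shows "l2norm (x_star - g xhat_star)
    \<le> 1 / (P * \<kappa>) * sqrt (\<Sum>i<n. (l2norm (B i *\<^sub>v r i (g_Om i (interior_block n_Om n_Ga xhat_star i))
                                                     (g_Ga i (interface_block n_Om n_Ga xhat_star i))))\<^sup>2)"
proof -
  let ?y = "g xhat_star"
  let ?res = "\<lambda>y i. r i (interior_block N_Om N_Ga y i) (interface_block N_Om N_Ga y i)"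
  have x_star: "x_star \<in> carrier_vec (total_dim n N_Om N_Ga)"
    and zero: "\<And>i. i < n \<Longrightarrow> ?res x_star i = 0\<^sub>v (N_r i)"
    using fom by (auto simp: fom_solution_def)
  have y: "?y \<in> carrier_vec (total_dim n N_Om N_Ga)"
    unfolding g_def by (rule lift_map_carrier) (rule g_Om g_Ga, assumption)+
  have y_image: "?y \<in> g ` S_ROM"
    using rom by (auto simp: is_local_minimizer_def)
  have res_carrier: "?res ?y i \<in> carrier_vec (N_r i)" if "i < n" for i
    by (rule funcset_mem[OF funcset_mem[OF r[OF that]]])
      (simp_all add: interior_block_def interface_block_def)
  have "\<kappa> * l2norm (x_star - ?y)
      \<le> sqrt (\<Sum>i<n. (l2norm (?res x_star i - ?res ?y i))\<^sup>2)"
    by (rule inverse_lipschitz[OF x_star y])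
  also have "\<dots> = sqrt (\<Sum>i<n. (l2norm (?res ?y i))\<^sup>2)"
    by (simp add: zero l2norm_zero_minus[OF res_carrier])
  finally have "P * (\<kappa> * l2norm (x_star - ?y)) \<le> P * sqrt (\<Sum>i<n. (l2norm (?res ?y i))\<^sup>2)"
    using P_pos by simp
  also have "\<dots> \<le> sqrt (\<Sum>i<n. (l2norm (B i *\<^sub>v ?res ?y i))\<^sup>2)"
    by (rule hyper_reduction[OF y_image])
  also have "\<dots> = sqrt (\<Sum>i<n. (l2norm (B i *\<^sub>v r i (g_Om i (interior_block n_Om n_Ga xhat_star i))
                                            (g_Ga i (interface_block n_Om n_Ga xhat_star i))))\<^sup>2)"
    unfolding g_def by (simp add: blocks_lift_map[OF g_Om g_Ga])
  finally show ?thesis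
    using P_pos kappa_pos by (simp add: field_simps)
qed

end
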